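(* Let $\mathcal{P}$ be a 2.5 player parity game and let $f$ be a Player $0$ strategy with profitable switches, i.e. $\mathrm{profit}(\mathcal{P},f)\neq\emptyset$. Then $\mathcal{I}_f\neq\emptyset$, and for all $f'\in\mathcal{I}_f$ we have $\mathrm{val}^{\mathcal{P}}_{f'}>\mathrm{val}^{\mathcal{P}}_{f}$.
   Context: A 2.5 player parity game is a tuple $\mathcal{P}=(V_0,V_1,V_r,E,\mathrm{prob},\mathrm{pri})$, where $V_0,V_1,V_r$ are finite disjoint sets of vertices (owned by Player $0$, Player $1$, and Player random), $V=V_0\cup V_1\cup V_r$, $E\subseteq V\times V$ is such that every $v\in V$ has at least one successor, $E_0=E\cap(V_0\times V)$, $\mathrm{prob}$ maps each $v\in V_r$ to a rational-valued probability distribution on $V$ with $\mathrm{prob}(v)(v')>0$ iff $(v,v')\in E$, and $\mathrm{pri}:V\to\mathbb{N}$ is the priority function. A play is an infinite path; Player $0$ wins it iff the minimal priority occurring infinitely often on it is even. A strategy of Player $\sigma\in\{0,1\}$ is always pure and memoryless: a map $f_\sigma:V_\sigma\to V$ with $(v,f_\sigma(v))\in E$ for all $v \in V_\sigma$; $\mathrm{Strats}_\sigma$ is the set of these. Fixing $f_0,f_1$ yields a Markov chain, and $\mathrm{val}^{\mathcal{P}}_{f_0,f_1}(v)$ is the probability that a play from $v$ is won by Player $0$; $\mathrm{val}^{\mathcal{P}}_{f_0}(v)=\inf_{f_1\in \mathrm{Strats}_1}\mathrm{val}^{\mathcal{P}}_{f_0,f_1}(v)$. $\mathrm{val}^{\mathcal{P}}_{f'}>\mathrm{val}^{\mathcal{P}}_{f}$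 means $\mathrm{val}^{\mathcal{P}}_{f'}(v)\geq\mathrm{val}^{\mathcal{P}}_{f}(v)$ for all $v\in V$ and $\mathrm{val}^{\mathcal{P}}_{f'}\neq\mathrm{val}^{\mathcal{P}}_{f}$. Profitable switches: $\mathrm{profit}(\mathcal{P},f)=\{(v,v')\in E_0 \mid \mathrm{val}^{\mathcal{P}}_f(v')>\mathrm{val}^{\mathcal{P}}_f(v)\}$. $\mathcal{I}_f=\{f'\in\mathrm{Strats}_0\mid f'\neq f$ and for all $v\in V_0$: $f'(v)=f(v)$ or $(v,f'(v))\in\mathrm{profit}(\mathcal{P},f)\}$. *)

theory Defs
  imports "HOL-Probability.Probability"
begin

definition chain_step :: "('v \<Rightarrow> 'v pmf) \<Rightarrow> 'v \<Rightarrow> nat \<Rightarrow> (nat \<Rightarrow> 'v) \<Rightarrow> 'v measure" where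
  "chain_step K v n \<omega> =
     measure_pmf (case n of 0 \<Rightarrow> return_pmf v | Suc m \<Rightarrow> K (\<omega> m))"

text \<open>
  The law of the Markov chain with transition kernel \<open>K\<close> started in \<open>v\<close>, as the Ionescu-Tulcea
  limit of its steps. The lemma \<open>emeasure_path_measure_cylinder\<close> below gives the probabilities
  of cylinder sets.
\<close>
definition path_measure :: "('v \<Rightarrow> 'v pmf) \<Rightarrow> 'v \<Rightarrow> (nat \<Rightarrow> 'v) measure" where
  "path_measure K v =
     projective_family.lim UNIV
       (Ionescu_Tulcea.CI (chain_step K v) (\<lambda>_. count_space UNIV)) (\<lambda>_. count_space UNIV)"

lemma Ionescu_Tulcea_chain_step:
  "Ionescu_Tulcea (chain_step K v) (\<lambda>_. count_space UNIV)"
proof (rule Ionescu_Tulcea.intro)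
  fix n
  let ?M = "\<lambda>_::nat. count_space (UNIV :: 'a set)"
  show "chain_step K v n \<in> measurable (PiM {0..<n} ?M) (subprob_algebra (?M n))"
  proof (cases n)
    case 0
    then show ?thesis
      by (auto simp: chain_step_def[abs_def] space_subprob_algebra
          intro!: prob_space_imp_subprob_space prob_space_measure_pmf)
  next
    case (Suc m)
    have "(\<lambda>x. measure_pmf (K x)) \<in> measurable (count_space UNIV) (subprob_algebra (?M n))"
      by (auto simp: space_subprob_algebra
          intro!: prob_space_imp_subprob_space prob_space_measure_pmf)
    moreover have "(\<lambda>\<omega>. \<omega> m) \<in> measurable (PiM {0..<n} ?M) (count_space UNIV)"
      using Suc by (intro measurable_component_singleton) auto
    ultimately show ?thesis
      unfolding chain_step_def[abs_def] Suc nat.case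
      by (rule measurable_compose[rotated])
  qed
next
  show "prob_space (chain_step K v i x)" for i x
    by (simp add: chain_step_def prob_space_measure_pmf)
qed

lemma space_path_measure [simp]: "space (path_measure K v) = UNIV"
  and sets_path_measure [measurable_cong, simp]:
    "sets (path_measure K v) = sets (PiM UNIV (\<lambda>_. count_space UNIV))"
proof -
  interpret Ionescu_Tulcea "chain_step K v" "\<lambda>_. count_space UNIV"
    by (rule Ionescu_Tulcea_chain_step)
  show "space (path_measure K v) = UNIV"
    by (simp add: path_measure_def space_PiM)
  show "sets (path_measure K v) = sets (PiM UNIV (\<lambda>_. count_space UNIV))"
    by (simp add: path_measure_def)
qed

lemma prob_space_path_measure: "prob_space (path_measure K v)"
proof -
  interpret Ionescu_Tulcea "chain_step K v" "\<lambda>_. count_space UNIV"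
    by (rule Ionescu_Tulcea_chain_step)
  interpret C: prob_space "C 0 0 (\<lambda>_. undefined)"
    by (rule prob_space_C) (simp add: space_PiM)
  have "emeasure PF.lim (PF.emb UNIV {} {\<lambda>_. undefined}) = emeasure (CI {}) {\<lambda>_. undefined}"
    by (rule lim) (auto simp: PiM_empty)
  also have "\<dots> = 1"
    using prob_space.emeasure_space_1[OF PF.prob_space_P[of "{}"]]
    by (simp add: CI_def space_PiM)
  finally show ?thesis
    by (intro prob_spaceI) (auto simp: path_measure_def prod_emb_def space_PiM restrict_def)
qed

lemma emeasure_path_measure_cylinder:
  "emeasure (path_measure K v) {\<omega>. \<forall>i\<le>n. \<omega> i = x i} =
     ennreal (of_bool (x 0 = v) * (\<Prod>i<n. pmf (K (x i)) (x (Suc i))))"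
proof -
  let ?M = "\<lambda>_::nat. count_space (UNIV :: 'a set)"
  interpret Ionescu_Tulcea "chain_step K v" ?M
    by (rule Ionescu_Tulcea_chain_step)
  define r where "r n = restrict x {0..<n}" for n
  have sng: "{r m} \<in> sets (PiM {0..<m} ?M)" for m
  proof -
    have "{r m} = (\<Pi>\<^sub>E i\<in>{0..<m}. {x i})"
      by (auto simp: r_def PiE_iff extensional_def restrict_def fun_eq_iff)
    then show ?thesis by simp
  qed
  have sp [simp]: "r m \<in> space (PiM {0..<m} ?M)" "(\<lambda>_. undefined) \<in> space (PiM {0..<0} ?M)" for m
    by (auto simp: r_def space_PiM)
  have step: "emeasure (C 0 (Suc m) (\<lambda>_. undefined)) {r (Suc m)} =
     emeasure (C 0 m (\<lambda>_. undefined)) {r m} * emeasure (chain_step K v m (r m)) {x m}" for m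
  proof -
    have "emeasure (C 0 (Suc m) (\<lambda>_. undefined)) {r (Suc m)} =
      (\<integral>\<^sup>+\<omega>. emeasure (eP m \<omega>) {r (Suc m)} \<partial>C 0 m (\<lambda>_. undefined))"
      using sng[of "Suc m"] measurable_eP[of m] space_C[OF sp(2), of m]
      by (simp, subst emeasure_bind[where N="PiM {0..<Suc m} ?M"])
         (auto simp: measurable_cong_sets[OF sets_C[OF sp(2)] refl])
    also have "\<dots> = (\<integral>\<^sup>+\<omega>. emeasure (chain_step K v m (r m)) {x m} * indicator {r m} \<omega>
        \<partial>C 0 m (\<lambda>_. undefined))"
    proof (rule nn_integral_cong)
      fix \<omega> assume "\<omega> \<in> space (C 0 m (\<lambda>_. undefined))"
      then have \<omega>: "\<omega> \<in> space (PiM {0..<m} ?M)" using space_C[OF sp(2), of m] by simp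
      then have ext: "\<omega> \<in> extensional {0..<m}" by (simp add: space_PiM PiE_iff)
      have "fun_upd \<omega> m -` {r (Suc m)} = (if \<omega> = r m then {x m} else {})"
      proof -
        have "fun_upd \<omega> m y = r (Suc m) \<longleftrightarrow> \<omega> = r m \<and> y = x m" for y
        proof
          assume eq: "fun_upd \<omega> m y = r (Suc m)"
          have "\<omega> i = r m i" for i
            using fun_cong[OF eq, of i] ext
            by (cases "i < m") (auto simp: r_def extensional_def)
          moreover have "y = x m" using fun_cong[OF eq, of m] by (simp add: r_def)
          ultimately show "\<omega> = r m \<and> y = x m" by auto
        next
          assume "\<omega> = r m \<and> y = x m"
          then show "fun_upd \<omega> m y = r (Suc m)"
            by (auto simp: r_def restrict_def fun_eq_iff)
        qed
        then show ?thesis by auto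
      qed
      then show "emeasure (eP m \<omega>) {r (Suc m)} =
          emeasure (chain_step K v m (r m)) {x m} * indicator {r m} \<omega>"
        by (subst emeasure_eP[OF \<omega> sng]) (auto simp: indicator_def)
    qed
    also have "\<dots> = emeasure (chain_step K v m (r m)) {x m} *
        emeasure (C 0 m (\<lambda>_. undefined)) {r m}"
      using sng[of m] sets_C[OF sp(2), of m] by (intro nn_integral_cmult_indicator) simp
    finally show ?thesis by (simp add: mult.commute)
  qed
  have C: "emeasure (C 0 (Suc m) (\<lambda>_. undefined)) {r (Suc m)} =
     ennreal (of_bool (x 0 = v) * (\<Prod>i<m. pmf (K (x i)) (x (Suc i))))" for m
  proof (induction m)
    case 0
    have "r 0 = (\<lambda>_. undefined)" by (simp add: r_def restrict_def)
    then show ?case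
      using sng[of 0] unfolding step
      by (auto simp: chain_step_def emeasure_pmf_single pmf_return indicator_def)
  next
    case (Suc m)
    have "emeasure (chain_step K v (Suc m) (r (Suc m))) {x (Suc m)}
        = ennreal (pmf (K (x m)) (x (Suc m)))"
      by (simp add: chain_step_def emeasure_pmf_single r_def)
    then show ?case
      unfolding step[of "Suc m"] Suc
      by (simp add: ennreal_mult'[symmetric] mult.assoc prod_nonneg)
  qed
  have "{\<omega>. \<forall>i\<le>n. \<omega> i = x i} = PF.emb UNIV {0..<Suc n} {r (Suc n)}"
    by (auto simp: prod_emb_def space_PiM r_def fun_eq_iff restrict_def less_Suc_eq_le)
       metis
  then have "emeasure (path_measure K v) {\<omega>. \<forall>i\<le>n. \<omega> i = x i} = emeasure (CI {0..<Suc n}) {r (Suc n)}"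
    unfolding path_measure_def using lim[of "{0..<Suc n}" "{r (Suc n)}"] sng by simp
  also have "\<dots> = emeasure (C 0 (Suc n) (\<lambda>_. undefined)) {r (Suc n)}"
    using emeasure_CI[of "{0..<Suc n}" "Suc n" "{r (Suc n)}"] sng[of "Suc n"]
    by (subst (asm) prod_emb_id) (auto simp: r_def simp del: C.simps)
  finally show ?thesis unfolding C .
qed


record 'v parity_game =
  verts0 :: "'v set"
  verts1 :: "'v set"
  vertsr :: "'v set"
  edges :: "('v \<times> 'v) set"
  trans_prob :: "'v \<Rightarrow> 'v pmf"
  priority :: "'v \<Rightarrow> nat"

definition verts :: "'v parity_game \<Rightarrow> 'v set" where
  "verts P = verts0 P \<union> verts1 P \<union> vertsr P"

locale parity_game =
  fixes P :: "'v parity_game"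
  assumes finite_verts: "finite (verts0 P)" "finite (verts1 P)" "finite (vertsr P)"
    and disjoint_verts: "verts0 P \<inter> verts1 P = {}" "verts0 P \<inter> vertsr P = {}"
      "verts1 P \<inter> vertsr P = {}"
    and edges_subset: "edges P \<subseteq> verts P \<times> verts P"
    and successor: "\<And>v. v \<in> verts P \<Longrightarrow> \<exists>w. (v, w) \<in> edges P"
    and trans_prob_rat: "\<And>v w. v \<in> vertsr P \<Longrightarrow> pmf (trans_prob P v) w \<in> \<rat>"
    and trans_prob_edges:
      "\<And>v w. v \<in> vertsr P \<Longrightarrow> pmf (trans_prob P v) w > 0 \<longleftrightarrow> (v, w) \<in> edges P"

definition plays :: "'v parity_game \<Rightarrow> (nat \<Rightarrow> 'v) set" where
  "plays P = {\<omega>. \<forall>n. (\<omega> n, \<omega> (Suc n)) \<in> edges P}"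

text \<open>
  Since there are finitely many vertices, some priority occurs infinitely often on each play, so
  the \<open>LEAST\<close> exists.
\<close>
definition won_plays :: "'v parity_game \<Rightarrow> (nat \<Rightarrow> 'v) set" where
  "won_plays P = {\<omega> \<in> plays P. even (LEAST k. \<exists>\<^sub>\<infinity>n. priority P (\<omega> n) = k)}"

text \<open>
  Strategies are extensional functions, so that equality of strategies is equality on the
  vertices owned by the respective player.
\<close>
definition strats0 :: "'v parity_game \<Rightarrow> ('v \<Rightarrow> 'v) set" where
  "strats0 P = (\<Pi>\<^sub>E v\<in>verts0 P. {w. (v, w) \<in> edges P})"

definition strats1 :: "'v parity_game \<Rightarrow> ('v \<Rightarrow> 'v) set" where
  "strats1 P = (\<Pi>\<^sub>E v\<in>verts1 P. {w. (v, w) \<in> edges P})"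

definition chain_kernel ::
  "'v parity_game \<Rightarrow> ('v \<Rightarrow> 'v) \<Rightarrow> ('v \<Rightarrow> 'v) \<Rightarrow> 'v \<Rightarrow> 'v pmf" where
  "chain_kernel P f0 f1 v =
     (if v \<in> verts0 P then return_pmf (f0 v)
      else if v \<in> verts1 P then return_pmf (f1 v)
      else trans_prob P v)"

definition val2 :: "'v parity_game \<Rightarrow> ('v \<Rightarrow> 'v) \<Rightarrow> ('v \<Rightarrow> 'v) \<Rightarrow> 'v \<Rightarrow> real" where
  "val2 P f0 f1 v = measure (path_measure (chain_kernel P f0 f1) v) (won_plays P)"

definition val :: "'v parity_game \<Rightarrow> ('v \<Rightarrow> 'v) \<Rightarrow> 'v \<Rightarrow> real" where
  "val P f0 v = (INF f1\<in>strats1 P. val2 P f0 f1 v)"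

definition val_greater :: "'v parity_game \<Rightarrow> ('v \<Rightarrow> 'v) \<Rightarrow> ('v \<Rightarrow> 'v) \<Rightarrow> bool" where
  "val_greater P f' f \<longleftrightarrow>
     (\<forall>v\<in>verts P. val P f' v \<ge> val P f v) \<and> (\<exists>v\<in>verts P. val P f' v \<noteq> val P f v)"

definition profit :: "'v parity_game \<Rightarrow> ('v \<Rightarrow> 'v) \<Rightarrow> ('v \<times> 'v) set" where
  "profit P f = {(v, v') \<in> edges P \<inter> (verts0 P \<times> verts P). val P f v' > val P f v}"

definition improvements :: "'v parity_game \<Rightarrow> ('v \<Rightarrow> 'v) \<Rightarrow> ('v \<Rightarrow> 'v) set" where
  "improvements P f =
     {f' \<in> strats0 P. f' \<noteq> f \<and> (\<forall>v\<in>verts0 P. f' v = f v \<or> (v, f' v) \<in> profit P f)}"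

text \<open>
  Measurability of the winning set, and non-emptiness and finiteness of the set over which the
  infimum is taken: neither \<^const>\<open>measure\<close> nor the infimum on the reals takes a default value.
\<close>
context parity_game
begin

lemma finite_edges: "finite (edges P)"
  using edges_subset finite_verts by (auto simp: verts_def intro: finite_subset)

lemma won_plays_measurable: "won_plays P \<in> sets (path_measure K v)"
proof -
  let ?S = "PiM UNIV (\<lambda>_::nat. count_space (UNIV :: 'a set))"
  have comp: "(\<lambda>\<omega>. \<omega> n) \<in> measurable ?S (count_space UNIV)" for n
    by (rule measurable_component_singleton) simp
  have [measurable]: "Measurable.pred ?S (\<lambda>\<omega>. Q (\<omega> n))" for Q n
    by (rule measurable_compose[OF comp]) simp
  have eq: "(\<omega> n, \<omega> (Suc n)) \<in> edges P \<longleftrightarrow> (\<exists>e\<in>edges P. \<omega> n = fst e \<and> \<omega> (Suc n) = snd e)"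
    for \<omega> :: "nat \<Rightarrow> 'v" and n
    by force
  have [measurable]: "Measurable.pred ?S (\<lambda>\<omega>. (\<omega> n, \<omega> (Suc n)) \<in> edges P)" for n
    unfolding eq using finite_edges by (intro pred_intros_finite) measurable
  have least: "(\<lambda>\<omega>. LEAST k. \<exists>\<^sub>\<infinity>n. priority P (\<omega> n) = k) \<in> measurable ?S (count_space UNIV)"
    unfolding INFM_nat by (intro measurable_Least) measurable
  have [measurable]: "Measurable.pred ?S (\<lambda>\<omega>. even (LEAST k. \<exists>\<^sub>\<infinity>n. priority P (\<omega> n) = k))"
    by (rule measurable_compose[OF least]) simp
  have "Measurable.pred ?S (\<lambda>\<omega>. (\<forall>n. (\<omega> n, \<omega> (Suc n)) \<in> edges P) \<and>
      even (LEAST k. \<exists>\<^sub>\<infinity>n. priority P (\<omega> n) = k))"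
    by (intro pred_intros_logic pred_intros_countable) measurable
  then have "{\<omega> \<in> space ?S. (\<forall>n. (\<omega> n, \<omega> (Suc n)) \<in> edges P) \<and>
      even (LEAST k. \<exists>\<^sub>\<infinity>n. priority P (\<omega> n) = k)} \<in> sets ?S"
    by (simp add: pred_def)
  then show ?thesis
    by (simp add: won_plays_def plays_def space_PiM)
qed

lemma strats1_nonempty: "strats1 P \<noteq> {}"
  using successor by (auto simp: strats1_def PiE_eq_empty_iff verts_def)

lemma finite_strats1: "finite (strats1 P)"
proof -
  have "finite {w. (v, w) \<in> edges P}" for v
    by (rule finite_subset[of _ "snd ` edges P"]) (use finite_edges in force)+
  then show ?thesis
    unfolding strats1_def using finite_verts by (intro finite_PiE) auto
qed

end

end

theory Submission
  imports Defs
begin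

text \<open>
  Fix an improvement \<open>f'\<close> and a counter strategy \<open>g\<close>. The function \<open>val P f\<close> is subharmonic for the
  chain of \<open>(f', g)\<close>, while \<open>val2 P f' g\<close> is harmonic, so their difference attains its maximum on a
  closed set where \<open>val P f\<close> is harmonic. Profitable switches strictly increase \<open>val P f\<close>, so there
  are none on this set; there \<open>f'\<close> plays like \<open>f\<close>, and the difference is at most 0. No
  recurrence theory is needed, and of the parity condition only prefix independence is used.

  Subharmonicity of \<open>val P f\<close> needs one counter strategy that is optimal at all vertices at once. It is
  obtained from the same comparison principle, by combining two strategies into one that is at
  least as good as both.
\<close>

section \<open>Markov chains on a finite closed set of states\<close>

lemma box_measurable:
  "{\<omega>. \<forall>i\<le>n. \<omega> i \<in> A i} \<in> sets (PiM UNIV (\<lambda>_::nat. count_space (UNIV :: 'v set)))"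
proof -
  let ?S = "PiM UNIV (\<lambda>_::nat. count_space (UNIV :: 'v set))"
  have "Measurable.pred ?S (\<lambda>\<omega>. \<omega> i \<in> A i)" for i
    by (rule measurable_compose[OF measurable_component_singleton[of i]]) simp_all
  then have "Measurable.pred ?S (\<lambda>\<omega>. \<forall>i\<in>{..n}. \<omega> i \<in> A i)"
    by (intro pred_intros_finite) auto
  then show ?thesis
    by (simp add: pred_def space_PiM Ball_def)
qed

lemma cylinder_measurable:
  "{\<omega>. \<forall>i\<le>n. \<omega> i = x i} \<in> sets (PiM UNIV (\<lambda>_::nat. count_space (UNIV :: 'v set)))"
  using box_measurable[of n "\<lambda>i. {x i}"] by simp

text \<open>Over finite sets \<open>A i\<close> the box is a finite disjoint union of point
  cylinders, indexed by extensional functions so that each prefix is counted once.\<close>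

lemma emeasure_box_eq_sum:
  fixes M :: "(nat \<Rightarrow> 'v) measure"
  assumes M: "sets M = sets (PiM UNIV (\<lambda>_. count_space UNIV))"
    and fin: "\<And>i. finite (A i)"
  shows "emeasure M {\<omega>. \<forall>i\<le>n. \<omega> i \<in> A i} =
    (\<Sum>x\<in>PiE {..n} A. emeasure M {\<omega>. \<forall>i\<le>n. \<omega> i = x i})"
proof -
  have "(\<Sum>x\<in>PiE {..n} A. emeasure M {\<omega>. \<forall>i\<le>n. \<omega> i = x i}) =
      emeasure M (\<Union>x\<in>PiE {..n} A. {\<omega>. \<forall>i\<le>n. \<omega> i = x i})"
  proof (rule sum_emeasure)
    show "disjoint_family_on (\<lambda>x. {\<omega>. \<forall>i\<le>n. \<omega> i = x i}) (PiE {..n} A)"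
      unfolding disjoint_family_on_def
      by (auto intro!: PiE_ext[of _ "{..n}" A])
  qed (use M cylinder_measurable fin in \<open>auto intro: finite_PiE\<close>)
  also have "(\<Union>x\<in>PiE {..n} A. {\<omega>. \<forall>i\<le>n. \<omega> i = x i}) = {\<omega>. \<forall>i\<le>n. \<omega> i \<in> A i}"
  proof safe
    fix \<omega> assume "\<forall>i\<le>n. \<omega> i \<in> A i"
    then show "\<omega> \<in> (\<Union>x\<in>PiE {..n} A. {\<omega>. \<forall>i\<le>n. \<omega> i = x i})"
      by (intro UN_I[of "restrict \<omega> {..n}"]) auto
  qed (auto simp: PiE_iff)
  finally show ?thesis ..
qed

text \<open>The type \<open>'v\<close> may be uncountable, so point cylinders alone need not
  determine a measure. As \<open>M\<close> stays in the finite set \<open>V\<close> almost surely,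
  every box can be cut down to \<open>V\<close>, where it is a finite union of point cylinders;
  agreement on these passes the staying property on to \<open>N\<close>.\<close>

lemma sequence_measure_eqI:
  fixes M N :: "(nat \<Rightarrow> 'v) measure"
  assumes "prob_space M" "prob_space N"
    and sM: "sets M = sets (PiM UNIV (\<lambda>_. count_space UNIV))"
    and sN: "sets N = sets (PiM UNIV (\<lambda>_. count_space UNIV))"
    and V: "finite V"
    and stay: "\<And>n. emeasure M {\<omega>. \<forall>i\<le>n. \<omega> i \<in> V} = 1"
    and eq: "\<And>n x. (\<And>i. i \<le> n \<Longrightarrow> x i \<in> V) \<Longrightarrow>
      emeasure M {\<omega>. \<forall>i\<le>n. \<omega> i = x i} = emeasure N {\<omega>. \<forall>i\<le>n. \<omega> i = x i}"
  shows "M = N"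
proof (rule measure_eqI_PiM_infinite[OF sM sN])
  interpret M: prob_space M by fact
  interpret N: prob_space N by fact
  have box: "emeasure M {\<omega>. \<forall>i\<le>n. \<omega> i \<in> A i \<inter> V} = emeasure N {\<omega>. \<forall>i\<le>n. \<omega> i \<in> A i \<inter> V}"
    for n A
    using V by (subst (1 2) emeasure_box_eq_sum) (auto simp: sM sN PiE_iff intro!: sum.cong eq)
  have stayN: "emeasure N {\<omega>. \<forall>i\<le>n. \<omega> i \<in> V} = 1" for n
    using box[of n "\<lambda>_. UNIV"] stay by simp
  have aeM: "AE \<omega> in M. \<forall>i\<le>n. \<omega> i \<in> V" for n
    using M.AE_prob_1[of "{\<omega>. \<forall>i\<le>n. \<omega> i \<in> V}"] stay[of n] by (simp add: M.emeasure_eq_measure)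
  have aeN: "AE \<omega> in N. \<forall>i\<le>n. \<omega> i \<in> V" for n
    using N.AE_prob_1[of "{\<omega>. \<forall>i\<le>n. \<omega> i \<in> V}"] stayN[of n] by (simp add: N.emeasure_eq_measure)
  fix A :: "nat \<Rightarrow> 'v set" and J :: "nat set"
  assume "finite J"
  then obtain n where n: "\<forall>i\<in>J. i \<le> n"
    by (auto simp: finite_nat_set_iff_bounded_le)
  \<comment> \<open>Void conditions outside \<open>J\<close> turn the box over \<open>J\<close> into
    one over the initial segment up to \<open>n\<close>.\<close>
  define B where "B i = (if i \<in> J then A i else UNIV)" for i
  have emb: "prod_emb UNIV (\<lambda>_. count_space UNIV) J (PiE J A) = {\<omega>. \<forall>i\<le>n. \<omega> i \<in> B i}"
    using n by (auto simp: prod_emb_def B_def PiE_iff space_PiM split: if_splits)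
  have "emeasure M {\<omega>. \<forall>i\<le>n. \<omega> i \<in> B i} = emeasure M {\<omega>. \<forall>i\<le>n. \<omega> i \<in> B i \<inter> V}"
    using aeM[of n] box_measurable[of n B] box_measurable[of n "\<lambda>i. B i \<inter> V"]
    by (intro emeasure_eq_AE) (auto simp: sM)
  also have "\<dots> = emeasure N {\<omega>. \<forall>i\<le>n. \<omega> i \<in> B i \<inter> V}"
    by (rule box)
  also have "\<dots> = emeasure N {\<omega>. \<forall>i\<le>n. \<omega> i \<in> B i}"
    using aeN[of n] box_measurable[of n B] box_measurable[of n "\<lambda>i. B i \<inter> V"]
    by (intro emeasure_eq_AE) (auto simp: sN)
  finally show "emeasure M (prod_emb UNIV (\<lambda>_. count_space UNIV) J (PiE J A)) =
      emeasure N (prod_emb UNIV (\<lambda>_. count_space UNIV) J (PiE J A))"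
    unfolding emb .
next
  show "finite_measure M"
    using assms(1) by (rule prob_space.finite_measure)
qed

text \<open>The probabilities of all \<open>V\<close>-valued prefixes add up to 1: summing over the
  last vertex first contributes a factor 1, because the kernel does not leave \<open>V\<close>, and
  induction on the length does the rest.\<close>

lemma path_measure_stays:
  assumes V: "finite V" and closed: "\<And>u. u \<in> V \<Longrightarrow> set_pmf (K u) \<subseteq> V" and v: "v \<in> V"
  shows "emeasure (path_measure K v) {\<omega>. \<forall>i\<le>n. \<omega> i \<in> V} = 1"
proof -
  define c where "c n x = of_bool (x 0 = v) * (\<Prod>i<n. pmf (K (x i)) (x (Suc i)))"
    for n and x :: "nat \<Rightarrow> 'a"
  have c_nonneg: "c n x \<ge> 0" for n x
    by (auto simp: c_def intro: prod_nonneg)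
  have c_Suc: "c (Suc n) (x(Suc n := y)) = c n x * pmf (K (x n)) y" for n x y
  proof -
    have "(\<Prod>i<n. pmf (K ((x(Suc n := y)) i)) ((x(Suc n := y)) (Suc i))) =
        (\<Prod>i<n. pmf (K (x i)) (x (Suc i)))"
      by (intro prod.cong) auto
    then show ?thesis
      by (simp add: c_def)
  qed
  have sum_c: "(\<Sum>x\<in>PiE {..n} (\<lambda>_. V). c n x) = 1"
  proof (induction n)
    case 0
    \<comment> \<open>Prefixes of a single vertex, as extensional functions on
      \<open>{..0}\<close>.\<close>
    define e :: "'a \<Rightarrow> nat \<Rightarrow> 'a" where "e y = (\<lambda>_. undefined)(0 := y)" for y
    have e: "PiE {..0::nat} (\<lambda>_. V) = e ` V"
    proof (intro equalityI subsetI)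
      fix x assume x: "x \<in> PiE {..0::nat} (\<lambda>_. V)"
      have "x = e (x 0)"
      proof
        show "x i = e (x 0) i" for i
          using PiE_arb[OF x, of i] by (cases "i = 0") (auto simp: e_def)
      qed
      then show "x \<in> e ` V"
        using x by blast
    qed (auto simp: e_def PiE_iff extensional_def)
    have inj: "inj_on e V"
      by (intro inj_onI) (metis e_def fun_upd_same)
    have "(\<Sum>x\<in>PiE {..0::nat} (\<lambda>_. V). c 0 x) = (\<Sum>y\<in>V. c 0 (e y))"
      unfolding e sum.reindex[OF inj] by simp
    then show ?case
      using V v by (simp add: c_def e_def of_bool_def)
  next
    case (Suc n)
    have *: "PiE {..Suc n} (\<lambda>_. V) = (\<lambda>(y, x). x(Suc n := y)) ` (V \<times> PiE {..n} (\<lambda>_. V))"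
      using PiE_insert_eq[of "Suc n" "{..n}" "\<lambda>_. V"] by (simp only: atMost_Suc)
    have inj: "inj_on (\<lambda>(y, x). x(Suc n := y)) (V \<times> PiE {..n} (\<lambda>_. V))"
      using inj_combinator[of "Suc n" "{..n}" "\<lambda>_. V"] by simp
    have "(\<Sum>x\<in>PiE {..Suc n} (\<lambda>_. V). c (Suc n) x) =
        (\<Sum>y\<in>V. \<Sum>x\<in>PiE {..n} (\<lambda>_. V). c (Suc n) (x(Suc n := y)))"
      unfolding * sum.cartesian_product sum.reindex[OF inj] by (simp add: case_prod_unfold)
    also have "\<dots> = (\<Sum>y\<in>V. \<Sum>x\<in>PiE {..n} (\<lambda>_. V). c n x * pmf (K (x n)) y)"
      unfolding c_Suc ..
    also have "\<dots> = (\<Sum>x\<in>PiE {..n} (\<lambda>_. V). c n x * (\<Sum>y\<in>V. pmf (K (x n)) y))"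
      by (subst sum.swap) (simp add: sum_distrib_left)
    also have "\<dots> = (\<Sum>x\<in>PiE {..n} (\<lambda>_. V). c n x)"
    proof (rule sum.cong[OF refl])
      fix x assume "x \<in> PiE {..n} (\<lambda>_. V)"
      then have "(\<Sum>y\<in>V. pmf (K (x n)) y) = 1"
        by (intro sum_pmf_eq_1 V closed) auto
      then show "c n x * (\<Sum>y\<in>V. pmf (K (x n)) y) = c n x"
        by simp
    qed
    finally show ?case
      using Suc by simp
  qed
  have "emeasure (path_measure K v) {\<omega>. \<forall>i\<le>n. \<omega> i \<in> V} = (\<Sum>x\<in>PiE {..n} (\<lambda>_. V). ennreal (c n x))"
    unfolding c_def
    by (subst emeasure_box_eq_sum) (simp_all only: sets_path_measure V emeasure_path_measure_cylinder)
  also have "\<dots> = 1"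
    using c_nonneg sum_c by simp
  finally show ?thesis .
qed

text \<open>Lets strategies be exchanged when they agree on a closed set that contains the initial
  vertex.\<close>

lemma path_measure_cong:
  assumes V: "finite V" and closed: "\<And>u. u \<in> V \<Longrightarrow> set_pmf (K u) \<subseteq> V" and v: "v \<in> V"
    and eq: "\<And>u. u \<in> V \<Longrightarrow> K u = K' u"
  shows "path_measure K v = path_measure K' v"
proof (rule sequence_measure_eqI[OF prob_space_path_measure prob_space_path_measure _ _ V])
  show "emeasure (path_measure K v) {\<omega>. \<forall>i\<le>n. \<omega> i \<in> V} = 1" for n
    by (rule path_measure_stays[OF V closed v])
  show "emeasure (path_measure K v) {\<omega>. \<forall>i\<le>n. \<omega> i = x i} =
      emeasure (path_measure K' v) {\<omega>. \<forall>i\<le>n. \<omega> i = x i}" if "\<And>i. i \<le> n \<Longrightarrow> x i \<in> V" for n x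
    using that eq by (simp add: emeasure_path_measure_cylinder)
qed simp_all

lemma measurable_case_nat_sequence:
  "case_nat v \<in> measurable (PiM UNIV (\<lambda>_::nat. count_space (UNIV :: 'v set)))
     (PiM UNIV (\<lambda>_::nat. count_space UNIV))"
proof (rule measurable_PiM_single')
  show "(\<lambda>\<omega>. case_nat v \<omega> i) \<in> measurable (PiM UNIV (\<lambda>_. count_space UNIV)) (count_space UNIV)"
    for i
    by (cases i) (simp_all add: measurable_component_singleton)
qed auto

text \<open>The Markov property at the first step: draw a successor \<open>w\<close> of
  \<open>v\<close>, run the chain from \<open>w\<close> and prepend \<open>v\<close>. Both laws give
  each cylinder the same product of transition probabilities.\<close>

lemma path_measure_unfold:
  assumes V: "finite V" and closed: "\<And>u. u \<in> V \<Longrightarrow> set_pmf (K u) \<subseteq> V" and v: "v \<in> V"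
  shows "path_measure K v = measure_pmf (K v) \<bind>
    (\<lambda>w. distr (path_measure K w) (PiM UNIV (\<lambda>_. count_space UNIV)) (case_nat v))"
proof -
  let ?S = "PiM UNIV (\<lambda>_::nat. count_space (UNIV :: 'a set))"
  let ?D = "\<lambda>w. distr (path_measure K w) ?S (case_nat v)"
  have meas: "case_nat v \<in> measurable (path_measure K w) ?S" for w
    by (subst measurable_cong_sets[OF sets_path_measure refl]) (rule measurable_case_nat_sequence)
  have prob: "prob_space (?D w)" for w
    by (rule prob_space.prob_space_distr[OF prob_space_path_measure meas])
  have D: "?D \<in> measurable (measure_pmf (K v)) (subprob_algebra ?S)"
    by (auto simp: space_subprob_algebra intro: prob_space_imp_subprob_space prob)
  show ?thesis
  proof (rule sequence_measure_eqI[OF prob_space_path_measure _ _ _ V])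
    show "prob_space (measure_pmf (K v) \<bind> ?D)"
      using prob D by (intro prob_space.prob_space_bind prob_space_measure_pmf) auto
    show "sets (measure_pmf (K v) \<bind> ?D) = sets ?S"
      by (rule sets_bind) simp_all
    show "emeasure (path_measure K v) {\<omega>. \<forall>i\<le>n. \<omega> i \<in> V} = 1" for n
      by (rule path_measure_stays[OF V closed v])
    fix n and x :: "nat \<Rightarrow> 'a"
    have *: "emeasure (measure_pmf (K v) \<bind> ?D) {\<omega>. \<forall>i\<le>n. \<omega> i = x i} =
        (\<integral>\<^sup>+w. emeasure (path_measure K w) {\<omega>. \<forall>i\<le>n. case_nat v \<omega> i = x i} \<partial>K v)"
      using cylinder_measurable[of n x]
      by (subst emeasure_bind[OF _ D])
         (auto intro!: nn_integral_cong simp: emeasure_distr[OF meas] vimage_def)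
    show "emeasure (path_measure K v) {\<omega>. \<forall>i\<le>n. \<omega> i = x i} =
        emeasure (measure_pmf (K v) \<bind> ?D) {\<omega>. \<forall>i\<le>n. \<omega> i = x i}"
    proof (cases n)
      case 0
      have "emeasure (path_measure K w) UNIV = 1" for w
        using prob_space.emeasure_space_1[OF prob_space_path_measure[of K w]] by simp
      then show ?thesis
        unfolding * using 0 by (auto simp: emeasure_path_measure_cylinder[of K v 0, simplified])
    next
      case (Suc m)
      \<comment> \<open>Coordinate 0 of the prepended path is the constant \<open>v\<close>; the
        other conditions form a cylinder shorter by one, whose own start \<open>x (Suc 0)\<close>
        selects a single \<open>w\<close> in the integral below.\<close>
      have shift: "{\<omega>. \<forall>i\<le>n. case_nat v \<omega> i = x i} =
          (if x 0 = v then {\<omega>. \<forall>i\<le>m. \<omega> i = x (Suc i)} else {})"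
        unfolding Suc by (auto simp: less_Suc_eq_le[symmetric] All_less_Suc2)
      have "(\<integral>\<^sup>+w. emeasure (path_measure K w) {\<omega>. \<forall>i\<le>n. case_nat v \<omega> i = x i} \<partial>K v) =
          (\<integral>\<^sup>+w. ennreal (of_bool (x 0 = v) *
             (\<Prod>i<m. pmf (K (x (Suc i))) (x (Suc (Suc i))))) * indicator {x (Suc 0)} w \<partial>K v)"
        unfolding shift
        by (intro nn_integral_cong) (auto simp: emeasure_path_measure_cylinder indicator_def)
      also have "\<dots> = ennreal (of_bool (x 0 = v) * (\<Prod>i<n. pmf (K (x i)) (x (Suc i))))"
        unfolding Suc
        by (subst nn_integral_cmult_indicator)
           (auto simp: emeasure_pmf_single ennreal_mult'[symmetric] prod.lessThan_Suc_shift
             mult.commute simp del: prod.lessThan_Suc)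
      finally show ?thesis
        unfolding * by (simp add: emeasure_path_measure_cylinder)
    qed
  qed simp
qed

section \<open>A comparison principle\<close>

lemma expectation_mono_finite:
  fixes u w :: "'v \<Rightarrow> real"
  assumes "finite (set_pmf p)" "\<And>a. a \<in> set_pmf p \<Longrightarrow> u a \<le> w a"
  shows "measure_pmf.expectation p u \<le> measure_pmf.expectation p w"
  using assms by (intro integral_mono_AE integrable_measure_pmf_finite) (auto simp: AE_measure_pmf_iff)

text \<open>The difference \<open>w - u\<close> is nonnegative on the support and has expectation 0,
  so it vanishes there.\<close>

lemma expectation_eq_imp_eq:
  fixes u w :: "'v \<Rightarrow> real"
  assumes fin: "finite (set_pmf p)" and le: "\<And>a. a \<in> set_pmf p \<Longrightarrow> u a \<le> w a"
    and ge: "measure_pmf.expectation p w \<le> measure_pmf.expectation p u" and a: "a \<in> set_pmf p"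
  shows "u a = w a"
proof -
  have int: "integrable p u" "integrable p w"
    using fin by (auto intro: integrable_measure_pmf_finite)
  have "measure_pmf.expectation p (\<lambda>a. w a - u a) = 0"
    using expectation_mono_finite[OF fin le, of "\<lambda>a. a"] ge int by simp
  then have "AE a in p. w a - u a = 0"
    using int le by (subst (asm) integral_nonneg_eq_0_iff_AE) (auto simp: AE_measure_pmf_iff)
  then show ?thesis
    using a by (auto simp: AE_measure_pmf_iff)
qed

text \<open>A maximum principle. Let \<open>M\<close> be the set where \<open>u - y\<close> attains
  its maximum \<open>c\<close>. At a vertex of \<open>M\<close> the mean of \<open>u - y\<close>
  over the successors is at least \<open>c\<close>, so all successors lie in \<open>M\<close>. On
  \<open>M\<close> the function \<open>u\<close> is \<open>y + c\<close>, hence harmonic, and the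
  vertex supplied by \<open>rec\<close> shows \<open>c \<le> 0\<close>.\<close>

lemma subharmonic_le_harmonic:
  fixes u y :: "'v \<Rightarrow> real"
  assumes V: "finite V" and closed: "\<And>v. v \<in> V \<Longrightarrow> set_pmf (K v) \<subseteq> V"
    and u: "\<And>v. v \<in> V \<Longrightarrow> u v \<le> measure_pmf.expectation (K v) u"
    and y: "\<And>v. v \<in> V \<Longrightarrow> y v = measure_pmf.expectation (K v) y"
    and rec: "\<And>M. \<lbrakk>M \<subseteq> V; M \<noteq> {}; \<And>v. v \<in> M \<Longrightarrow> set_pmf (K v) \<subseteq> M;
      \<And>v. v \<in> M \<Longrightarrow> u v = measure_pmf.expectation (K v) u\<rbrakk> \<Longrightarrow> \<exists>v\<in>M. u v \<le> y v"
    and v: "v \<in> V"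
  shows "u v \<le> y v"
proof -
  define c where "c = Max ((\<lambda>v. u v - y v) ` V)"
  define M where "M = {v \<in> V. u v - y v = c}"
  have le: "u v - y v \<le> c" if "v \<in> V" for v
    using V that by (simp add: c_def)
  have fin: "finite (set_pmf (K v))" if "v \<in> V" for v
    using closed[OF that] V by (rule finite_subset)
  have int: "integrable (K v) u" "integrable (K v) y" if "v \<in> V" for v
    using fin[OF that] by (auto intro: integrable_measure_pmf_finite)
  have M_closed: "set_pmf (K v) \<subseteq> M" if "v \<in> M" for v
  proof
    fix w assume w: "w \<in> set_pmf (K v)"
    have v: "v \<in> V" "u v - y v = c" using that by (auto simp: M_def)
    have "u w - y w = c"
    proof (rule expectation_eq_imp_eq[OF fin[OF v(1)] _ _ w, of "\<lambda>w. u w - y w" "\<lambda>_. c"])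
      show "measure_pmf.expectation (K v) (\<lambda>_. c) \<le> measure_pmf.expectation (K v) (\<lambda>w. u w - y w)"
        using u[OF v(1)] y[OF v(1)] int[OF v(1)] v(2) by simp
    qed (use le closed v in auto)
    then show "w \<in> M" using closed v w by (auto simp: M_def)
  qed
  have "\<exists>v\<in>M. u v \<le> y v"
  proof (rule rec[OF _ _ M_closed])
    show "M \<subseteq> V" by (auto simp: M_def)
    have "c \<in> (\<lambda>v. u v - y v) ` V"
      unfolding c_def using V v by (intro Max_in) auto
    then show "M \<noteq> {}" by (auto simp: M_def)
    fix v assume v: "v \<in> M"
    then have V: "v \<in> V" by (simp add: M_def)
    have "measure_pmf.expectation (K v) u = measure_pmf.expectation (K v) (\<lambda>w. y w + c)"
      using M_closed[OF v]
      by (intro integral_cong_AE) (auto simp: AE_measure_pmf_iff M_def)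
    also have "\<dots> = y v + c"
      using int[OF V] y[OF V] by simp
    finally show "u v = measure_pmf.expectation (K v) u"
      using v by (simp add: M_def)
  qed
  then have "c \<le> 0" by (auto simp: M_def)
  then show ?thesis using le[OF v] by linarith
qed

text \<open>The dual form, by negating both functions.\<close>

lemma harmonic_le_superharmonic:
  fixes u y :: "'v \<Rightarrow> real"
  assumes V: "finite V" and closed: "\<And>v. v \<in> V \<Longrightarrow> set_pmf (K v) \<subseteq> V"
    and u: "\<And>v. v \<in> V \<Longrightarrow> measure_pmf.expectation (K v) u \<le> u v"
    and y: "\<And>v. v \<in> V \<Longrightarrow> y v = measure_pmf.expectation (K v) y"
    and rec: "\<And>M. \<lbrakk>M \<subseteq> V; M \<noteq> {}; \<And>v. v \<in> M \<Longrightarrow> set_pmf (K v) \<subseteq> M;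
      \<And>v. v \<in> M \<Longrightarrow> u v = measure_pmf.expectation (K v) u\<rbrakk> \<Longrightarrow> \<exists>v\<in>M. y v \<le> u v"
    and v: "v \<in> V"
  shows "y v \<le> u v"
proof -
  have "- u v \<le> - y v"
  proof (rule subharmonic_le_harmonic[OF V closed, where u = "\<lambda>v. - u v" and y = "\<lambda>v. - y v"])
    fix M
    assume "M \<subseteq> V" "M \<noteq> {}" "\<And>v. v \<in> M \<Longrightarrow> set_pmf (K v) \<subseteq> M"
      and "\<And>v. v \<in> M \<Longrightarrow> - u v = measure_pmf.expectation (K v) (\<lambda>v. - u v)"
    then have "\<exists>v\<in>M. y v \<le> u v"
      by (intro rec) auto
    then show "\<exists>v\<in>M. - u v \<le> - y v"
      by simp
  qed (use u y v in auto)
  then show ?thesis by simp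
qed

section \<open>Values of positional strategies\<close>

lemma path_measure_start: "AE \<omega> in path_measure K v. \<omega> 0 = v"
proof -
  interpret prob_space "path_measure K v"
    by (rule prob_space_path_measure)
  have "emeasure (path_measure K v) {\<omega>. \<omega> 0 = v} = 1"
    using emeasure_path_measure_cylinder[of K v 0 "\<lambda>_. v"] by simp
  then show ?thesis
    using AE_prob_1[of "{\<omega>. \<omega> 0 = v}"] by (simp add: emeasure_eq_measure)
qed

context parity_game
begin

lemma finite_all_verts: "finite (verts P)"
  using finite_verts by (simp add: verts_def)

lemma chain_kernel_edges:
  assumes "f \<in> strats0 P" "g \<in> strats1 P" "v \<in> verts P" "w \<in> set_pmf (chain_kernel P f g v)"
  shows "(v, w) \<in> edges P"
  using assms trans_prob_edges[of v w]
  by (auto simp: chain_kernel_def strats0_def strats1_def verts_def PiE_iff pmf_positive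
      split: if_splits)

lemma chain_kernel_closed:
  assumes "f \<in> strats0 P" "g \<in> strats1 P" "v \<in> verts P"
  shows "set_pmf (chain_kernel P f g v) \<subseteq> verts P"
  using chain_kernel_edges[OF assms] edges_subset by auto

lemma finite_chain_kernel:
  assumes "f \<in> strats0 P" "g \<in> strats1 P" "v \<in> verts P"
  shows "finite (set_pmf (chain_kernel P f g v))"
  using chain_kernel_closed[OF assms] finite_all_verts by (rule finite_subset)

text \<open>Prefix independence: a shift by one does not change which priorities occur infinitely
  often. The edge makes the prepended path a play.\<close>

lemma case_nat_won_plays_iff:
  assumes "(v, \<omega> 0) \<in> edges P"
  shows "case_nat v \<omega> \<in> won_plays P \<longleftrightarrow> \<omega> \<in> won_plays P"
proof -
  have "case_nat v \<omega> \<in> plays P \<longleftrightarrow> \<omega> \<in> plays P"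
    unfolding plays_def using assms by (auto split: nat.splits)
  moreover have "(\<exists>\<^sub>\<infinity>n. priority P (case_nat v \<omega> n) = k) \<longleftrightarrow> (\<exists>\<^sub>\<infinity>n. priority P (\<omega> n) = k)" for k
    unfolding frequently_def
    by (subst MOST_Suc_iff[of "\<lambda>n. priority P (case_nat v \<omega> n) \<noteq> k", symmetric]) (simp only: nat.case)
  ultimately show ?thesis
    by (simp add: won_plays_def)
qed

lemma val2_nonneg: "0 \<le> val2 P f g v"
  by (simp add: val2_def)

text \<open>The first-step decomposition of the path law, evaluated on the winning set, which
  prepending \<open>v\<close> preserves almost surely.\<close>

lemma val2_harmonic:
  assumes f: "f \<in> strats0 P" and g: "g \<in> strats1 P" and v: "v \<in> verts P"
  shows "val2 P f g v = measure_pmf.expectation (chain_kernel P f g v) (val2 P f g)"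
proof -
  let ?K = "chain_kernel P f g"
  let ?S = "PiM UNIV (\<lambda>_::nat. count_space (UNIV :: 'v set))"
  let ?D = "\<lambda>w. distr (path_measure ?K w) ?S (case_nat v)"
  have meas: "case_nat v \<in> measurable (path_measure ?K w) ?S" for w
    by (subst measurable_cong_sets[OF sets_path_measure refl]) (rule measurable_case_nat_sequence)
  have prob: "prob_space (?D w)" for w
    by (rule prob_space.prob_space_distr[OF prob_space_path_measure meas])
  have D: "?D \<in> measurable (measure_pmf (?K v)) (subprob_algebra ?S)"
    by (auto simp: space_subprob_algebra intro: prob_space_imp_subprob_space prob)
  have won: "won_plays P \<in> sets ?S"
    using won_plays_measurable by simp
  have emeasure_val2: "emeasure (path_measure ?K w) (won_plays P) = ennreal (val2 P f g w)" for w
    unfolding val2_def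
    by (rule finite_measure.emeasure_eq_measure[OF prob_space.finite_measure[OF prob_space_path_measure]])
  have "emeasure (path_measure ?K v) (won_plays P) = (\<integral>\<^sup>+w. emeasure (?D w) (won_plays P) \<partial>?K v)"
    by (subst path_measure_unfold[OF finite_all_verts chain_kernel_closed[OF f g] v])
       (use won in \<open>auto intro!: emeasure_bind D\<close>)
  also have "\<dots> = (\<integral>\<^sup>+w. ennreal (val2 P f g w) \<partial>?K v)"
  proof (intro nn_integral_cong_AE AE_pmfI)
    fix w assume "w \<in> set_pmf (?K v)"
    then have edge: "(v, w) \<in> edges P"
      using chain_kernel_edges[OF f g v] by simp
    have "emeasure (?D w) (won_plays P) =
        emeasure (path_measure ?K w) (case_nat v -` won_plays P \<inter> space (path_measure ?K w))"
      by (rule emeasure_distr[OF meas won])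
    also have "\<dots> = emeasure (path_measure ?K w) (won_plays P)"
    proof (rule emeasure_eq_AE)
      show "AE \<omega> in path_measure ?K w.
          \<omega> \<in> case_nat v -` won_plays P \<inter> space (path_measure ?K w) \<longleftrightarrow> \<omega> \<in> won_plays P"
        \<comment> \<open>Prefix independence requires an edge from \<open>v\<close> to the first
          vertex of the path, and that vertex is \<open>w\<close> only almost surely.\<close>
        using path_measure_start[of w ?K]
        by eventually_elim (use edge in \<open>simp add: case_nat_won_plays_iff\<close>)
    qed (use won measurable_sets[OF meas won] in simp_all)
    finally show "emeasure (?D w) (won_plays P) = ennreal (val2 P f g w)"
      by (simp add: emeasure_val2)
  qed
  also have "\<dots> = ennreal (measure_pmf.expectation (?K v) (val2 P f g))"
    by (intro nn_integral_eq_integral integrable_measure_pmf_finite finite_chain_kernel[OF f g v]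
        AE_pmfI val2_nonneg)
  finally have "ennreal (val2 P f g v) = ennreal (measure_pmf.expectation (?K v) (val2 P f g))"
    unfolding emeasure_val2 .
  \<comment> \<open>\<open>ennreal\<close> is injective on nonnegative reals only.\<close>
  moreover have "0 \<le> measure_pmf.expectation (?K v) (val2 P f g)"
    by (intro integral_nonneg_AE AE_pmfI val2_nonneg)
  ultimately show ?thesis
    using val2_nonneg[of f g v] by (subst (asm) ennreal_inj)
qed

lemma val2_cong:
  assumes M: "M \<subseteq> verts P"
    and closed: "\<And>v. v \<in> M \<Longrightarrow> set_pmf (chain_kernel P f g v) \<subseteq> M"
    and eq: "\<And>v. v \<in> M \<Longrightarrow> chain_kernel P f g v = chain_kernel P f' g' v"
    and v: "v \<in> M"
  shows "val2 P f g v = val2 P f' g' v"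
  unfolding val2_def
  by (subst path_measure_cong[of M "chain_kernel P f g" v "chain_kernel P f' g'",
        OF finite_subset[OF M finite_all_verts] closed v eq]) simp_all

section \<open>The value under optimal counter play\<close>

lemma val_le_val2: "g \<in> strats1 P \<Longrightarrow> val P f v \<le> val2 P f g v"
  unfolding val_def using finite_strats1 by (intro cINF_lower) auto

lemma val_greatest: "(\<And>g. g \<in> strats1 P \<Longrightarrow> c \<le> val2 P f g v) \<Longrightarrow> c \<le> val P f v"
  unfolding val_def using strats1_nonempty by (intro cINF_greatest) auto

text \<open>Every counter strategy yields the same value at \<open>v\<close> and at
  \<open>f v\<close>, so the two infima run over the same numbers.\<close>

lemma val_verts0:
  assumes f: "f \<in> strats0 P" and v: "v \<in> verts0 P"
  shows "val P f v = val P f (f v)"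
  unfolding val_def
proof (rule INF_cong)
  fix g assume "g \<in> strats1 P"
  then show "val2 P f g v = val2 P f g (f v)"
    using val2_harmonic[OF f, of g v] v by (simp add: verts_def chain_kernel_def)
qed simp

text \<open>
  The combined strategy follows at each vertex whichever of the two strategies has the smaller
  value there. The minimum of the two values is superharmonic for it, and on a closed set where
  this minimum is harmonic the play follows one of the two strategies forever.
\<close>
lemma ex_strats1_le_both:
  assumes f: "f \<in> strats0 P" and g1: "g1 \<in> strats1 P" and g2: "g2 \<in> strats1 P"
  shows "\<exists>g\<in>strats1 P. \<forall>v\<in>verts P. val2 P f g v \<le> min (val2 P f g1 v) (val2 P f g2 v)"
proof -
  define y1 y2 where "y1 = val2 P f g1" and "y2 = val2 P f g2"
  define u where "u v = min (y1 v) (y2 v)" for v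
  define g where "g v = (if y1 v \<le> y2 v then g1 v else g2 v)" for v
  have g: "g \<in> strats1 P"
    using g1 g2 by (auto simp: g_def strats1_def PiE_iff extensional_def)
  let ?K = "chain_kernel P f g"
  note fin = finite_chain_kernel[OF f g]
  have K1: "?K v = chain_kernel P f g1 v" and u1: "u v = y1 v" if "y1 v \<le> y2 v" for v
    using that by (auto simp: chain_kernel_def g_def u_def)
  have K2: "?K v = chain_kernel P f g2 v" and u2: "u v = y2 v" if "\<not> y1 v \<le> y2 v" for v
    using that by (auto simp: chain_kernel_def g_def u_def)
  have E1: "u v = measure_pmf.expectation (?K v) y1" if "y1 v \<le> y2 v" "v \<in> verts P" for v
    using val2_harmonic[OF f g1 that(2)] K1[OF that(1)] u1[OF that(1)] by (simp add: y1_def)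
  have E2: "u v = measure_pmf.expectation (?K v) y2" if "\<not> y1 v \<le> y2 v" "v \<in> verts P" for v
    using val2_harmonic[OF f g2 that(2)] K2[OF that(1)] u2[OF that(1)] by (simp add: y2_def)
  have "val2 P f g v \<le> u v" if "v \<in> verts P" for v
  proof (rule harmonic_le_superharmonic[OF finite_all_verts chain_kernel_closed[OF f g] _
        val2_harmonic[OF f g] _ that])
    fix v assume v: "v \<in> verts P"
    show "measure_pmf.expectation (?K v) u \<le> u v"
      using expectation_mono_finite[OF fin[OF v], of u y1]
        expectation_mono_finite[OF fin[OF v], of u y2] E1[OF _ v] E2[OF _ v]
      by (cases "y1 v \<le> y2 v") (auto simp: u_def)
  next
    fix M
    assume M: "M \<subseteq> verts P" "M \<noteq> {}" and closed: "\<And>v. v \<in> M \<Longrightarrow> set_pmf (?K v) \<subseteq> M"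
      and harm: "\<And>v. v \<in> M \<Longrightarrow> u v = measure_pmf.expectation (?K v) u"
    show "\<exists>v\<in>M. val2 P f g v \<le> u v"
    proof (cases "\<exists>v\<in>M. y1 v \<le> y2 v")
      case True
      \<comment> \<open>On \<open>N\<close> both \<open>y1\<close> and \<open>u\<close> have mean
        \<open>u v\<close> over the successors of \<open>v\<close>. Since \<open>u \<le> y1\<close>,
        they agree at every successor, so the play stays in \<open>N\<close> and keeps following
        \<open>g1\<close>.\<close>
      define N where "N = {v \<in> M. y1 v \<le> y2 v}"
      have "set_pmf (?K v) \<subseteq> N" if "v \<in> N" for v
      proof
        fix w assume w: "w \<in> set_pmf (?K v)"
        have v: "v \<in> M" "v \<in> verts P" "y1 v \<le> y2 v" using that M by (auto simp: N_def)
        have "measure_pmf.expectation (?K v) y1 \<le> measure_pmf.expectation (?K v) u"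
          using E1[OF v(3,2)] harm[OF v(1)] by simp
        then have "u w = y1 w"
          by (rule expectation_eq_imp_eq[OF fin[OF v(2)] _ _ w, rotated]) (simp add: u_def)
        then show "w \<in> N" using closed[OF v(1)] w by (auto simp: N_def u_def min_def split: if_splits)
      qed
      then have eq: "val2 P f g v = val2 P f g1 v" if "v \<in> N" for v
        using M K1 that by (intro val2_cong[of N]) (auto simp: N_def)
      obtain v where "v \<in> M" "y1 v \<le> y2 v"
        using True by blast
      then show ?thesis
        using eq[of v] u1[of v] by (intro bexI[of _ v]) (auto simp: N_def y1_def)
    next
      case False
      \<comment> \<open>Now \<open>g\<close> follows \<open>g2\<close> on the whole closed set
        \<open>M\<close>.\<close>
      then have eq: "val2 P f g v = val2 P f g2 v" if "v \<in> M" for v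
        using M K2 that closed False by (intro val2_cong[of M]) auto
      obtain v where "v \<in> M"
        using M by blast
      then show ?thesis
        using eq[of v] u2[of v] False by (intro bexI[of _ v]) (auto simp: y2_def)
    qed
  qed
  then show ?thesis
    using g by (auto simp: u_def y1_def y2_def)
qed

text \<open>There are finitely many counter strategies; combining them pairwise gives one that is
  below all of them at every vertex, so it attains the infimum everywhere.\<close>

lemma ex_optimal_strats1:
  assumes f: "f \<in> strats0 P"
  shows "\<exists>g\<in>strats1 P. \<forall>v\<in>verts P. val2 P f g v = val P f v"
proof -
  have "\<exists>g\<in>strats1 P. \<forall>h\<in>G. \<forall>v\<in>verts P. val2 P f g v \<le> val2 P f h v"
    if "finite G" "G \<noteq> {}" "G \<subseteq> strats1 P" for G
    using that
  proof (induction G rule: finite_ne_induct)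
    case (insert h G)
    then obtain g where g: "g \<in> strats1 P" "\<forall>h\<in>G. \<forall>v\<in>verts P. val2 P f g v \<le> val2 P f h v"
      by auto
    obtain g' where "g' \<in> strats1 P"
        "\<forall>v\<in>verts P. val2 P f g' v \<le> min (val2 P f g v) (val2 P f h v)"
      using ex_strats1_le_both[OF f g(1), of h] insert.prems by auto
    then show ?case
      using g(2) by (intro bexI[of _ g']) force+
  qed auto
  from this[OF finite_strats1 strats1_nonempty order_refl]
  obtain g where g: "g \<in> strats1 P" "\<And>h v. h \<in> strats1 P \<Longrightarrow> v \<in> verts P \<Longrightarrow> val2 P f g v \<le> val2 P f h v"
    by blast
  then have "val2 P f g v = val P f v" if "v \<in> verts P" for v
    using that by (intro antisym val_greatest val_le_val2) auto
  then show ?thesis using g(1) by blast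
qed

text \<open>If \<open>w\<close> had a smaller value than \<open>v\<close>, redirecting an optimal
  counter strategy at \<open>v\<close> to \<open>w\<close> would not raise the value at any vertex
  and would bring the value at \<open>v\<close> down to at most that of \<open>w\<close>, against
  the definition of \<open>val\<close> as an infimum.\<close>

lemma val_verts1_le:
  assumes f: "f \<in> strats0 P" and v: "v \<in> verts1 P" and edge: "(v, w) \<in> edges P"
  shows "val P f v \<le> val P f w"
proof (rule ccontr)
  assume "\<not> ?thesis"
  then have less: "val P f w < val P f v" by simp
  have vV: "v \<in> verts P" and wV: "w \<in> verts P" and v0: "v \<notin> verts0 P"
    using v edge edges_subset disjoint_verts by (auto simp: verts_def)
  obtain g where g: "g \<in> strats1 P" and opt: "\<And>v. v \<in> verts P \<Longrightarrow> val2 P f g v = val P f v"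
    using ex_optimal_strats1[OF f] by blast
  define g' where "g' = g(v := w)"
  have g': "g' \<in> strats1 P"
    using g v edge by (auto simp: g'_def strats1_def PiE_iff extensional_def)
  let ?K = "chain_kernel P f g'"
  have Kv: "?K v = return_pmf w"
    using v v0 by (simp add: chain_kernel_def g'_def)
  have K: "?K x = chain_kernel P f g x" if "x \<noteq> v" for x
    using that by (simp add: chain_kernel_def g'_def)
  have "val2 P f g' x \<le> val2 P f g x" if "x \<in> verts P" for x
  proof (rule harmonic_le_superharmonic[OF finite_all_verts chain_kernel_closed[OF f g'] _
        val2_harmonic[OF f g'] _ that])
    fix x assume x: "x \<in> verts P"
    show "measure_pmf.expectation (?K x) (val2 P f g) \<le> val2 P f g x"
    proof (cases "x = v")
      case True
      then show ?thesis using Kv less opt vV wV by simp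
    next
      case False
      then show ?thesis using val2_harmonic[OF f g x] K by simp
    qed
  next
    fix M
    assume M: "M \<subseteq> verts P" "M \<noteq> {}" and closed: "\<And>x. x \<in> M \<Longrightarrow> set_pmf (?K x) \<subseteq> M"
      and harm: "\<And>x. x \<in> M \<Longrightarrow> val2 P f g x = measure_pmf.expectation (?K x) (val2 P f g)"
    \<comment> \<open>Harmonicity at \<open>v\<close> would equate the values of \<open>v\<close>
      and \<open>w\<close>. Away from \<open>v\<close> the strategies \<open>g\<close> and
      \<open>g'\<close> agree.\<close>
    have "v \<notin> M"
      using harm[of v] Kv less opt vV wV by auto
    then have "?K x = chain_kernel P f g x" if "x \<in> M" for x
      using that by (intro K) auto
    then have "val2 P f g' x = val2 P f g x" if "x \<in> M" for x
      using that M closed by (intro val2_cong[of M]) auto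
    then show "\<exists>x\<in>M. val2 P f g' x \<le> val2 P f g x"
      using M by auto
  qed
  then have "val2 P f g' w \<le> val P f w"
    using opt wV by force
  moreover have "val2 P f g' v = val2 P f g' w"
    using val2_harmonic[OF f g' vV] Kv by simp
  ultimately show False
    using val_le_val2[OF g', of f v] less by simp
qed

text \<open>An infimum does not commute with an expectation in general; it does here because a
  single counter strategy attains all the infima.\<close>

lemma val_vertsr:
  assumes f: "f \<in> strats0 P" and v: "v \<in> vertsr P"
  shows "val P f v = measure_pmf.expectation (trans_prob P v) (val P f)"
proof -
  obtain g where g: "g \<in> strats1 P" and opt: "\<And>v. v \<in> verts P \<Longrightarrow> val2 P f g v = val P f v"
    using ex_optimal_strats1[OF f] by blast
  have vV: "v \<in> verts P" and K: "chain_kernel P f g v = trans_prob P v"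
    using v disjoint_verts by (auto simp: verts_def chain_kernel_def)
  have "val P f v = measure_pmf.expectation (trans_prob P v) (val2 P f g)"
    using val2_harmonic[OF f g vV] opt[OF vV] K by simp
  also have "\<dots> = measure_pmf.expectation (trans_prob P v) (val P f)"
    using chain_kernel_closed[OF f g vV] opt K
    by (intro integral_cong_AE) (auto simp: AE_measure_pmf_iff)
  finally show ?thesis .
qed

section \<open>Improvement by profitable switches\<close>

text \<open>The bound is proved against each fixed \<open>g\<close>, so that it passes to the
  infimum over counter strategies.\<close>

lemma val_le_val2_improvement:
  assumes f: "f \<in> strats0 P" and f': "f' \<in> strats0 P" and g: "g \<in> strats1 P"
    and switch: "\<And>v. v \<in> verts0 P \<Longrightarrow> f' v = f v \<or> (v, f' v) \<in> profit P f"
    and v: "v \<in> verts P"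
  shows "val P f v \<le> val2 P f' g v"
proof (rule subharmonic_le_harmonic[OF finite_all_verts chain_kernel_closed[OF f' g] _
      val2_harmonic[OF f' g] _ v])
  let ?K = "chain_kernel P f' g"
  fix v assume v: "v \<in> verts P"
  consider "v \<in> verts0 P" | "v \<in> verts1 P" "v \<notin> verts0 P"
    | "v \<in> vertsr P" "v \<notin> verts0 P" "v \<notin> verts1 P"
    using v by (auto simp: verts_def)
  then show "val P f v \<le> measure_pmf.expectation (?K v) (val P f)"
  proof cases
    case 1
    then show ?thesis
      using switch[OF 1] val_verts0[OF f 1] by (auto simp: chain_kernel_def profit_def)
  next
    case 2
    then show ?thesis
      using g val_verts1_le[OF f 2(1), of "g v"]
      by (auto simp: chain_kernel_def strats1_def PiE_iff)
  next
    case 3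
    then show ?thesis
      using val_vertsr[OF f 3(1)] by (simp add: chain_kernel_def)
  qed
next
  let ?K = "chain_kernel P f' g"
  fix M
  assume M: "M \<subseteq> verts P" "M \<noteq> {}" and closed: "\<And>v. v \<in> M \<Longrightarrow> set_pmf (?K v) \<subseteq> M"
    and harm: "\<And>v. v \<in> M \<Longrightarrow> val P f v = measure_pmf.expectation (?K v) (val P f)"
  \<comment> \<open>Harmonicity reads \<open>val P f v = val P f (f' v)\<close> here, whereas a
    profitable switch makes this a strict inequality.\<close>
  have "f' v = f v" if "v \<in> M" "v \<in> verts0 P" for v
    using harm[OF that(1)] switch[OF that(2)] that(2) by (auto simp: chain_kernel_def profit_def)
  then have "val2 P f' g v = val2 P f g v" if "v \<in> M" for v
    using that M closed by (intro val2_cong[of M]) (auto simp: chain_kernel_def)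
  then show "\<exists>v\<in>M. val P f v \<le> val2 P f' g v"
    using M val_le_val2[OF g] by auto
qed

text \<open>One profitable switch on its own is an improvement; it changes \<open>f\<close>, because
  the edge chosen by \<open>f\<close> preserves the value and so is not profitable.\<close>

lemma improvements_nonempty:
  assumes f: "f \<in> strats0 P" and profit: "profit P f \<noteq> {}"
  shows "improvements P f \<noteq> {}"
proof -
  obtain v w where vw: "(v, w) \<in> profit P f"
    using profit by auto
  then have v: "v \<in> verts0 P" "(v, w) \<in> edges P" "val P f v < val P f w"
    by (auto simp: profit_def)
  then have "w \<noteq> f v"
    using val_verts0[OF f v(1)] by auto
  then have "f(v := w) \<in> improvements P f"
    using f v vw
    by (auto simp: improvements_def strats0_def PiE_iff extensional_def fun_upd_idem_iff)
  then show ?thesis by blast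
qed

text \<open>Strictness shows at any switched vertex \<open>v\<close>: the new value of
  \<open>v\<close> is the new value of \<open>f' v\<close>, which is at least the old value of
  \<open>f' v\<close>, which exceeds the old value of \<open>v\<close>.\<close>

lemma improvement_val_greater:
  assumes f: "f \<in> strats0 P" and "f' \<in> improvements P f"
  shows "val_greater P f' f"
proof -
  have f': "f' \<in> strats0 P" and neq: "f' \<noteq> f"
    and switch: "\<And>v. v \<in> verts0 P \<Longrightarrow> f' v = f v \<or> (v, f' v) \<in> profit P f"
    using assms(2) by (auto simp: improvements_def)
  have le: "val P f v \<le> val P f' v" if "v \<in> verts P" for v
    using that by (intro val_greatest val_le_val2_improvement[OF f f' _ switch])
  \<comment> \<open>Strategies are extensional, so distinct ones differ at a vertex of Player
    0.\<close>
  obtain v where v: "v \<in> verts0 P" "f' v \<noteq> f v"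
    using PiE_ext[OF f'[unfolded strats0_def] f[unfolded strats0_def]] neq by blast
  then have "f' v \<in> verts P" "val P f v < val P f (f' v)"
    using switch by (auto simp: profit_def)
  then have "val P f v < val P f' v"
    using le[of "f' v"] val_verts0[OF f' v(1)] by simp
  then show ?thesis
    using le v(1) by (auto simp: val_greater_def verts_def intro!: bexI[of _ v])
qed

end

theorem corollary2:
  fixes P :: "'v parity_game" and f :: "'v \<Rightarrow> 'v"
  assumes "parity_game P"
    and "f \<in> strats0 P"
    and "profit P f \<noteq> {}"
  shows "improvements P f \<noteq> {} \<and> (\<forall>f'\<in>improvements P f. val_greater P f' f)"
proof -
  interpret parity_game P by fact
  show ?thesis
    using improvements_nonempty improvement_val_greater assms(2,3) by blast
qed

end
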